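(* Let $X$ be a hyperbolic geodesic semimetric space that satisfies (B1) and (B2). Then the relation $\leq$ is a quasiorder (i.e. reflexive and transitive) on the set of geodesic rays and geodesic anti-rays of $X$.
   Context: A semimetric on a set $X$ is a map $d\colon X\times X\to[0,\infty]$ with $d(x,y)=0$ if and only if $x=y$, and $d(x,y)\le d(x,z)+d(z,y)$ (no symmetry). Put $\mathcal B^+_r(x)=\{y: d(x,y)\le r\}$ (out-ball), $\mathcal B^-_r(x)=\{y: d(y,x)\le r\}$ (in-ball), and $\mathcal B^{\pm}_r(Y)=\bigcup_{y\in Y}\mathcal B^{\pm}_r(y)$ for $Y\subseteq X$ (or $Y$ a path, meaning its image). The forward topology $\mathcal O_f$ is generated by the open out-balls $\{y: d(x,y)<r\}$, the backward topology $\mathcal O_b$ by the open in-balls $\{y: d(y,x)<r\}$. A directed path from $x$ to $y$ is a map $P\colon[a,b]\to X$ ($a<b$ real) with $P(a)=x$ (starting point), $P(b)=y$ (end point) that is continuous with respect to the forward topologies and with respect to the backward topologies, where real intervals carry the semimetric $d(s,t)=t-s$ if $s\le t$ and $\infty$ otherwise. Its length is $\ell(P)=\lim_{N\to\infty}\sum_{i=1}^N d(P(t_{i-1}),P(t_i))$ with $t_i=a+i(b-a)/N$. It is a geodesic if $\ell(P)=d(x,y)$. $X$ is geodesic if there is a geodesic from $x$ to $y$ whenever $d(x,y)<\infty$. A geodesic triangle consists of three points and three geodesics (its sides), one between every two of these points (in one of the two directions). It is $\delta$-thin if for every labelling $P,Q,R$ of its sides such that the starting point of $P$ is the starting or the end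 point of $Q$ and the end point of $P$ is the starting or the end point of $R$, we have $P\subseteq\mathcal B^+_\delta(Q)\cup\mathcal B^-_\delta(R)$. $X$ is $\delta$-hyperbolic ($\delta\ge0$) if all geodesic triangles are $\delta$-thin, and hyperbolic if this holds for some $\delta$. (B1): there is $f\colon\mathbb R\to\mathbb R$ such that for all $x\in X$, $r\ge0$ and $y,z\in\mathcal B^+_r(x)$, $d(y,z)$ is either $\infty$ or at most $f(r)$. (B2): the same with $\mathcal B^-_r(x)$ in place of $\mathcal B^+_r(x)$. A ray is a map $R\colon[0,\infty)\to X$, continuous with respect to the forward and backward topologies, such that for all $x\in X$, $r\ge0$ there is $p\ge 0$ with $R([p,\infty))\cap\mathcal B^+_r(x)=\emptyset$. An anti-ray is a map $R\colon(-\infty,0]\to X$, continuous in the same sense, such that for all $x\in X$, $r\ge 0$ there is $p\le0$ with $R((-\infty,p])\cap\mathcal B^-_r(x)=\emptyset$. A (anti-)ray is geodesic if all its finite directed subpaths are geodesics. For geodesic rays or anti-rays $R_1,R_2$ write $R_1\le R_2$ if there is $M\ge0$ such that for every $r\ge0$ and $x\in X$ there is a directed path from a point of $R_1$ to a point of $R_2$ of length at most $M$ outside of (i.e. disjoint from) $\mathcal B^+_r(x)\cup\mathcal B^-_r(x)$. *)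

theory Defs
  imports "HOL-Analysis.Analysis" "HOL-Library.Multiset"
begin

definition semimetric_space :: "'a set \<Rightarrow> ('a \<Rightarrow> 'a \<Rightarrow> ennreal) \<Rightarrow> bool" where
  "semimetric_space X d \<longleftrightarrow>
     (\<forall>x\<in>X. \<forall>y\<in>X. d x y = 0 \<longleftrightarrow> x = y) \<and>
     (\<forall>x\<in>X. \<forall>y\<in>X. \<forall>z\<in>X. d x y \<le> d x z + d z y)"

definition out_ball :: "'a set \<Rightarrow> ('a \<Rightarrow> 'a \<Rightarrow> ennreal) \<Rightarrow> real \<Rightarrow> 'a \<Rightarrow> 'a set" where
  "out_ball X d r x = {y \<in> X. d x y \<le> ennreal r}"

definition in_ball :: "'a set \<Rightarrow> ('a \<Rightarrow> 'a \<Rightarrow> ennreal) \<Rightarrow> real \<Rightarrow> 'a \<Rightarrow> 'a set" where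
  "in_ball X d r x = {y \<in> X. d y x \<le> ennreal r}"

definition out_ball_set :: "'a set \<Rightarrow> ('a \<Rightarrow> 'a \<Rightarrow> ennreal) \<Rightarrow> real \<Rightarrow> 'a set \<Rightarrow> 'a set" where
  "out_ball_set X d r Y = (\<Union>y\<in>Y. out_ball X d r y)"

definition in_ball_set :: "'a set \<Rightarrow> ('a \<Rightarrow> 'a \<Rightarrow> ennreal) \<Rightarrow> real \<Rightarrow> 'a set \<Rightarrow> 'a set" where
  "in_ball_set X d r Y = (\<Union>y\<in>Y. in_ball X d r y)"

definition forward_topology :: "'a set \<Rightarrow> ('a \<Rightarrow> 'a \<Rightarrow> ennreal) \<Rightarrow> 'a topology" where
  "forward_topology X d =
     topology_generated_by {{y \<in> X. d x y < ennreal r} | x r. x \<in> X \<and> 0 < r}"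

definition backward_topology :: "'a set \<Rightarrow> ('a \<Rightarrow> 'a \<Rightarrow> ennreal) \<Rightarrow> 'a topology" where
  "backward_topology X d =
     topology_generated_by {{y \<in> X. d y x < ennreal r} | x r. x \<in> X \<and> 0 < r}"

definition real_semimetric :: "real \<Rightarrow> real \<Rightarrow> ennreal" where
  "real_semimetric s t = (if s \<le> t then ennreal (t - s) else \<infinity>)"

definition bicontinuous_on ::
  "'a set \<Rightarrow> ('a \<Rightarrow> 'a \<Rightarrow> ennreal) \<Rightarrow> real set \<Rightarrow> (real \<Rightarrow> 'a) \<Rightarrow> bool" where
  "bicontinuous_on X d I P \<longleftrightarrow>
     continuous_map (forward_topology I real_semimetric) (forward_topology X d) P \<and>
     continuous_map (backward_topology I real_semimetric) (backward_topology X d) P"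

text \<open>A path carries its parameter interval; only the values of the function on that
  interval matter.\<close>

datatype 'a dpath = DPath (lower: real) (upper: real) (map_of_path: "real \<Rightarrow> 'a")

definition start_point :: "'a dpath \<Rightarrow> 'a" where
  "start_point P = map_of_path P (lower P)"

definition end_point :: "'a dpath \<Rightarrow> 'a" where
  "end_point P = map_of_path P (upper P)"

definition dpath_image :: "'a dpath \<Rightarrow> 'a set" where
  "dpath_image P = map_of_path P ` {lower P..upper P}"

definition directed_path :: "'a set \<Rightarrow> ('a \<Rightarrow> 'a \<Rightarrow> ennreal) \<Rightarrow> 'a dpath \<Rightarrow> bool" where
  "directed_path X d P \<longleftrightarrow>
     lower P < upper P \<and> bicontinuous_on X d {lower P..upper P} (map_of_path P)"

text \<open>The length is stated as a limit relation, so that having a length includes the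
  convergence of the sums.\<close>

definition has_length :: "('a \<Rightarrow> 'a \<Rightarrow> ennreal) \<Rightarrow> 'a dpath \<Rightarrow> ennreal \<Rightarrow> bool" where
  "has_length d P l \<longleftrightarrow>
     (let t = (\<lambda>N i. lower P + real i * (upper P - lower P) / real N) in
       (\<lambda>N. \<Sum>i=1..N. d (map_of_path P (t N (i - 1))) (map_of_path P (t N i)))
         \<longlonglongrightarrow> l)"

definition geodesic :: "'a set \<Rightarrow> ('a \<Rightarrow> 'a \<Rightarrow> ennreal) \<Rightarrow> 'a dpath \<Rightarrow> bool" where
  "geodesic X d P \<longleftrightarrow>
     directed_path X d P \<and> has_length d P (d (start_point P) (end_point P))"

definition geodesic_space :: "'a set \<Rightarrow> ('a \<Rightarrow> 'a \<Rightarrow> ennreal) \<Rightarrow> bool" where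
  "geodesic_space X d \<longleftrightarrow>
     (\<forall>x\<in>X. \<forall>y\<in>X. d x y < \<infinity> \<longrightarrow>
        (\<exists>P. geodesic X d P \<and> start_point P = x \<and> end_point P = y))"

definition geodesic_between ::
  "'a set \<Rightarrow> ('a \<Rightarrow> 'a \<Rightarrow> ennreal) \<Rightarrow> 'a \<Rightarrow> 'a \<Rightarrow> 'a dpath \<Rightarrow> bool" where
  "geodesic_between X d x y P \<longleftrightarrow> geodesic X d P \<and>
     (start_point P = x \<and> end_point P = y \<or> start_point P = y \<and> end_point P = x)"

text \<open>Degenerate triangles (with coinciding corners) are allowed.\<close>

definition geodesic_triangle :: "'a set \<Rightarrow> ('a \<Rightarrow> 'a \<Rightarrow> ennreal) \<Rightarrow>
    'a \<Rightarrow> 'a \<Rightarrow> 'a \<Rightarrow> 'a dpath \<Rightarrow> 'a dpath \<Rightarrow> 'a dpath \<Rightarrow> bool" where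
  "geodesic_triangle X d x y z A B C \<longleftrightarrow> x \<in> X \<and> y \<in> X \<and> z \<in> X \<and>
     geodesic_between X d x y A \<and> geodesic_between X d y z B \<and> geodesic_between X d z x C"

text \<open>The multiset equation says that \<open>P, Q, R\<close> is a labelling of the sides \<open>A, B, C\<close>.\<close>

definition thin_sides :: "'a set \<Rightarrow> ('a \<Rightarrow> 'a \<Rightarrow> ennreal) \<Rightarrow> real \<Rightarrow>
    'a dpath \<Rightarrow> 'a dpath \<Rightarrow> 'a dpath \<Rightarrow> bool" where
  "thin_sides X d \<delta> A B C \<longleftrightarrow>
     (\<forall>P Q R. {#P, Q, R#} = {#A, B, C#} \<and>
        start_point P \<in> {start_point Q, end_point Q} \<and>
        end_point P \<in> {start_point R, end_point R} \<longrightarrow>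
        dpath_image P \<subseteq>
          out_ball_set X d \<delta> (dpath_image Q) \<union> in_ball_set X d \<delta> (dpath_image R))"

definition delta_hyperbolic :: "'a set \<Rightarrow> ('a \<Rightarrow> 'a \<Rightarrow> ennreal) \<Rightarrow> real \<Rightarrow> bool" where
  "delta_hyperbolic X d \<delta> \<longleftrightarrow>
     (\<forall>x y z A B C. geodesic_triangle X d x y z A B C \<longrightarrow> thin_sides X d \<delta> A B C)"

definition hyperbolic :: "'a set \<Rightarrow> ('a \<Rightarrow> 'a \<Rightarrow> ennreal) \<Rightarrow> bool" where
  "hyperbolic X d \<longleftrightarrow> (\<exists>\<delta>\<ge>0. delta_hyperbolic X d \<delta>)"

definition B1 :: "'a set \<Rightarrow> ('a \<Rightarrow> 'a \<Rightarrow> ennreal) \<Rightarrow> bool" where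
  "B1 X d \<longleftrightarrow> (\<exists>f :: real \<Rightarrow> real. \<forall>x\<in>X. \<forall>r\<ge>0.
     \<forall>y\<in>out_ball X d r x. \<forall>z\<in>out_ball X d r x. d y z = \<infinity> \<or> d y z \<le> ennreal (f r))"

definition B2 :: "'a set \<Rightarrow> ('a \<Rightarrow> 'a \<Rightarrow> ennreal) \<Rightarrow> bool" where
  "B2 X d \<longleftrightarrow> (\<exists>f :: real \<Rightarrow> real. \<forall>x\<in>X. \<forall>r\<ge>0.
     \<forall>y\<in>in_ball X d r x. \<forall>z\<in>in_ball X d r x. d y z = \<infinity> \<or> d y z \<le> ennreal (f r))"

definition is_ray :: "'a set \<Rightarrow> ('a \<Rightarrow> 'a \<Rightarrow> ennreal) \<Rightarrow> (real \<Rightarrow> 'a) \<Rightarrow> bool" where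
  "is_ray X d R \<longleftrightarrow> bicontinuous_on X d {0..} R \<and>
     (\<forall>x\<in>X. \<forall>r\<ge>0. \<exists>p\<ge>0. R ` {p..} \<inter> out_ball X d r x = {})"

definition is_antiray :: "'a set \<Rightarrow> ('a \<Rightarrow> 'a \<Rightarrow> ennreal) \<Rightarrow> (real \<Rightarrow> 'a) \<Rightarrow> bool" where
  "is_antiray X d R \<longleftrightarrow> bicontinuous_on X d {..0} R \<and>
     (\<forall>x\<in>X. \<forall>r\<ge>0. \<exists>p\<le>0. R ` {..p} \<inter> in_ball X d r x = {})"

definition geodesic_ray :: "'a set \<Rightarrow> ('a \<Rightarrow> 'a \<Rightarrow> ennreal) \<Rightarrow> (real \<Rightarrow> 'a) \<Rightarrow> bool" where
  "geodesic_ray X d R \<longleftrightarrow> is_ray X d R \<and>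
     (\<forall>a b. 0 \<le> a \<and> a < b \<longrightarrow> geodesic X d (DPath a b R))"

definition geodesic_antiray :: "'a set \<Rightarrow> ('a \<Rightarrow> 'a \<Rightarrow> ennreal) \<Rightarrow> (real \<Rightarrow> 'a) \<Rightarrow> bool" where
  "geodesic_antiray X d R \<longleftrightarrow> is_antiray X d R \<and>
     (\<forall>a b. a < b \<and> b \<le> 0 \<longrightarrow> geodesic X d (DPath a b R))"

text \<open>The tag records the domain \<open>[0,\<infinity>)\<close> or \<open>(-\<infinity>,0]\<close>; the values of the function
  elsewhere are irrelevant.\<close>

datatype 'a gen_ray = Ray "real \<Rightarrow> 'a" | Antiray "real \<Rightarrow> 'a"

primrec gen_ray_image :: "'a gen_ray \<Rightarrow> 'a set" where
  "gen_ray_image (Ray R) = R ` {0..}"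
| "gen_ray_image (Antiray R) = R ` {..0}"

definition geodesic_rays_antirays :: "'a set \<Rightarrow> ('a \<Rightarrow> 'a \<Rightarrow> ennreal) \<Rightarrow> 'a gen_ray set" where
  "geodesic_rays_antirays X d =
     Ray ` {R. geodesic_ray X d R} \<union> Antiray ` {R. geodesic_antiray X d R}"

definition ray_le :: "'a set \<Rightarrow> ('a \<Rightarrow> 'a \<Rightarrow> ennreal) \<Rightarrow> 'a gen_ray \<Rightarrow> 'a gen_ray \<Rightarrow> bool" where
  "ray_le X d R1 R2 \<longleftrightarrow> (\<exists>M::real. M \<ge> 0 \<and> (\<forall>r\<ge>0. \<forall>x\<in>X. \<exists>P l.
     directed_path X d P \<and>
     start_point P \<in> gen_ray_image R1 \<and> end_point P \<in> gen_ray_image R2 \<and>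
     has_length d P l \<and> l \<le> ennreal M \<and>
     dpath_image P \<inter> (out_ball X d r x \<union> in_ball X d r x) = {}))"

end

theory Submission imports Defs begin

text \<open>
Bounded distances can replace the paths and balls in the definition of \<open>\<le>\<close>. Parametrise every
geodesic ray and anti-ray outward by \<open>[0,\<infinity>)\<close>. Both kinds leave all out-balls and all in-balls: for a
ray, points in an in-ball are at finite distance in the direction of the ray, so by (B2) they are
at bounded distance, and they lie in one out-ball around the first of them. Hence \<open>R1 \<le> R2\<close> holds
iff for some finite \<open>M\<close> there are, arbitrarily far out on \<open>R1\<close> and on \<open>R2\<close>, points of \<open>R1\<close> at
distance at most \<open>M\<close> to points of \<open>R2\<close> (\<open>ray_le_iff_asymp_le\<close>): a geodesic between two
such points stays close to its ends and so avoids any given ball. In this form reflexivity is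
trivial.

For transitivity, let \<open>R1 \<le> R2 \<le> R3\<close>, where \<open>R2\<close> is a ray. The main point
(\<open>forward_line_shadowed\<close>) is that every far point \<open>q\<close> of \<open>R2\<close> is within bounded
distance from \<open>R1\<close>; then a point of \<open>R2\<close> that is close to \<open>R3\<close> can be reached from \<open>R1\<close>, too.
To see this, choose a connection from \<open>a \<in> R1\<close> to \<open>b \<in> R2\<close> before \<open>q\<close> and a connection from \<open>a'\<close>
to \<open>b'\<close> far beyond \<open>q\<close>, each of length at most \<open>M\<close>, and a geodesic \<open>D\<close> from \<open>a\<close> to \<open>b'\<close>. The triangle
\<open>a, b, b'\<close> shows that every point of \<open>D\<close> is either \<open>\<delta>\<close>-close from the first connection or
\<open>\<delta>\<close>-close to \<open>R2\<close>. Moving along \<open>D\<close>, one passes from points that are near the first connection or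
reach \<open>R2\<close> before \<open>q\<close> to points that reach \<open>R2\<close> behind \<open>q\<close>. If the transition happens near the first
connection, then \<open>a\<close> has bounded distance to \<open>b\<close> and to a point of \<open>R2\<close> behind \<open>q\<close>, so (B1) bounds the
segment of \<open>R2\<close> between them, which contains \<open>q\<close>, and \<open>q\<close> is near \<open>a\<close>. Otherwise the same argument,
applied to the transition point and the two points of \<open>R2\<close> that it reaches, shows that the transition
point has bounded distance to \<open>q\<close>. By the triangle \<open>a, a', b'\<close> it is \<open>\<delta>\<close>-close from \<open>R1\<close>, as otherwise it
would have bounded distance to \<open>b'\<close>, and by (B1) so would \<open>q\<close>.

If \<open>R2\<close> is an anti-ray, reverse all distances. This turns rays into anti-rays and exchanges (B1)
with (B2), while thinness of triangles is preserved. To make this symmetry available without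
reversing paths, the main argument is carried out for an abstract relation \<open>geo p q S\<close>
(\<open>S\<close> is the image of a geodesic from \<open>p\<close> to \<open>q\<close>) subject to a self-dual list of axioms, the locale
\<open>directed_hyperbolic\<close>. The axioms follow from continuity and the definition of length
(\<open>directed_path_cover\<close>, \<open>has_length_ge\<close>).
\<close>

section \<open>Semimetrics and their reversal\<close>

lemma ennreal_le_add_cancel:
  fixes a b c :: ennreal
  assumes "a + b \<le> c" shows "a \<le> c" "b \<le> c"
  using assms by (auto intro: order_trans[OF _ assms] add_increasing add_increasing2)

lemma semimetric_self: "semimetric_space X d \<Longrightarrow> x \<in> X \<Longrightarrow> d x x = 0"
  unfolding semimetric_space_def by blast

lemma semimetric_triangle:
  "semimetric_space X d \<Longrightarrow> x \<in> X \<Longrightarrow> y \<in> X \<Longrightarrow> z \<in> X \<Longrightarrow> d x z \<le> d x y + d y z"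
  unfolding semimetric_space_def by blast

lemma B1_flip: "B1 X (\<lambda>x y. d y x) \<longleftrightarrow> B2 X d"
  and B2_flip: "B2 X (\<lambda>x y. d y x) \<longleftrightarrow> B1 X d"
  unfolding B1_def B2_def out_ball_def in_ball_def by blast+

lemma semimetric_space_flip:
  assumes "semimetric_space X d" shows "semimetric_space X (\<lambda>x y. d y x)"
  using assms unfolding semimetric_space_def by (metis add.commute)

section \<open>Lines in abstract hyperbolic spaces\<close>

text \<open>A ray is a forward line for \<open>geo\<close>; an anti-ray, parametrised outward, is a forward line for the
reversal of \<open>geo\<close>; both are lines.\<close>

definition line :: "('a \<Rightarrow> 'a \<Rightarrow> 'a set \<Rightarrow> bool) \<Rightarrow> (real \<Rightarrow> 'a) \<Rightarrow> bool" where
  "line geo R \<longleftrightarrow> (\<forall>s t. 0 \<le> s \<and> s < t \<longrightarrow>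
     geo (R s) (R t) (R ` {s..t}) \<or> geo (R t) (R s) (R ` {s..t}))"

definition forward_line :: "('a \<Rightarrow> 'a \<Rightarrow> 'a set \<Rightarrow> bool) \<Rightarrow> (real \<Rightarrow> 'a) \<Rightarrow> bool" where
  "forward_line geo R \<longleftrightarrow> (\<forall>s t. 0 \<le> s \<and> s < t \<longrightarrow> geo (R s) (R t) (R ` {s..t}))"

text \<open>With the reversed distance in place of \<open>d\<close>, this says that \<open>R\<close> leaves all in-balls.\<close>

definition escapes_out_balls :: "'a set \<Rightarrow> ('a \<Rightarrow> 'a \<Rightarrow> ennreal) \<Rightarrow> (real \<Rightarrow> 'a) \<Rightarrow> bool" where
  "escapes_out_balls X d R \<longleftrightarrow> (\<forall>x\<in>X. \<forall>r<top. \<exists>p\<ge>0. \<forall>t\<ge>p. \<not> d x (R t) \<le> r)"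

definition asymp_le :: "('a \<Rightarrow> 'a \<Rightarrow> ennreal) \<Rightarrow> (real \<Rightarrow> 'a) \<Rightarrow> (real \<Rightarrow> 'a) \<Rightarrow> bool" where
  "asymp_le d R1 R2 \<longleftrightarrow> (\<exists>M<top. \<forall>n. \<exists>s\<ge>n. \<exists>t\<ge>n. d (R1 s) (R2 t) \<le> M)"

definition escaping_line ::
  "'a set \<Rightarrow> ('a \<Rightarrow> 'a \<Rightarrow> ennreal) \<Rightarrow> ('a \<Rightarrow> 'a \<Rightarrow> 'a set \<Rightarrow> bool) \<Rightarrow> (real \<Rightarrow> 'a) \<Rightarrow> bool" where
  "escaping_line X d geo R \<longleftrightarrow> (forward_line geo R \<or> forward_line (\<lambda>p q. geo q p) R) \<and>
     escapes_out_balls X d R \<and> escapes_out_balls X (\<lambda>x y. d y x) R"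

lemma forward_line_imp_line: "forward_line geo R \<Longrightarrow> line geo R"
  unfolding forward_line_def line_def by blast

lemma line_flip: "line (\<lambda>p q. geo q p) R \<longleftrightarrow> line geo R"
  unfolding line_def by blast

lemma escaping_line_imp_line: "escaping_line X d geo R \<Longrightarrow> line geo R"
  unfolding escaping_line_def using forward_line_imp_line line_flip[of geo] by blast

lemma asymp_le_flip: "asymp_le (\<lambda>x y. d y x) R1 R2 \<longleftrightarrow> asymp_le d R2 R1"
  unfolding asymp_le_def by blast

text \<open>\<open>geo p q S\<close> stands for: \<open>S\<close> is the image of a geodesic from \<open>p\<close> to \<open>q\<close>. The axiom
\<open>geo_connected\<close> takes the place of continuity: a point that passes along a geodesic from \<open>A\<close> to \<open>B\<close>
makes the transition at small distance, where \<open>1\<close> stands for any positive constant.\<close>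

locale directed_hyperbolic =
  fixes X :: "'a set" and d :: "'a \<Rightarrow> 'a \<Rightarrow> ennreal"
    and geo :: "'a \<Rightarrow> 'a \<Rightarrow> 'a set \<Rightarrow> bool" and \<delta> :: ennreal
  assumes semimetric: "semimetric_space X d"
    and geo_ends: "geo p q S \<Longrightarrow> p \<in> S \<and> q \<in> S \<and> S \<subseteq> X \<and> d p q < top"
    and geo_between: "geo p q S \<Longrightarrow> e \<in> S \<Longrightarrow> d p e + d e q \<le> d p q"
    and geo_exists: "p \<in> X \<Longrightarrow> q \<in> X \<Longrightarrow> d p q < top \<Longrightarrow> \<exists>S. geo p q S"
    and geo_connected: "geo p q S \<Longrightarrow> p \<in> A \<Longrightarrow> q \<in> B \<Longrightarrow> S \<subseteq> A \<union> B \<Longrightarrow>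
      \<exists>a\<in>A \<inter> S. \<exists>b\<in>B \<inter> S. d a b \<le> 1"
    and delta_finite: "\<delta> < top"
    and thin: "geo p q S \<Longrightarrow> geo p r T \<or> geo r p T \<Longrightarrow> geo q r U \<or> geo r q U \<Longrightarrow> e \<in> S \<Longrightarrow>
      (\<exists>g\<in>T. d g e \<le> \<delta>) \<or> (\<exists>g\<in>U. d e g \<le> \<delta>)"
    and B1: "B1 X d" and B2: "B2 X d"
begin

text \<open>All axioms are invariant under reversal, so every statement below also holds with the
directions exchanged.\<close>

lemma dual: "directed_hyperbolic X (\<lambda>x y. d y x) (\<lambda>p q. geo q p) \<delta>"
proof (unfold_locales)
  show "semimetric_space X (\<lambda>x y. d y x)" by (rule semimetric_space_flip[OF semimetric])
  show "B1 X (\<lambda>x y. d y x)" "B2 X (\<lambda>x y. d y x)"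
    by (simp_all only: B1_flip[of X d] B2_flip[of X d] B1 B2)
  show "\<delta> < top" by (rule delta_finite)
  show "p \<in> S \<and> q \<in> S \<and> S \<subseteq> X \<and> d q p < top" if "geo q p S" for p q S
    using geo_ends[OF that] by blast
  show "d e p + d q e \<le> d q p" if "geo q p S" "e \<in> S" for p q e S
    using geo_between[OF that] by (simp add: add.commute)
  show "\<exists>S. geo q p S" if "p \<in> X" "q \<in> X" "d q p < top" for p q
    using geo_exists that by blast
  show "\<exists>a\<in>A \<inter> S. \<exists>b\<in>B \<inter> S. d b a \<le> 1"
    if "geo q p S" "p \<in> A" "q \<in> B" "S \<subseteq> A \<union> B" for p q A B S
    using geo_connected[of q p S B A] that by blast
  show "(\<exists>g\<in>T. d e g \<le> \<delta>) \<or> (\<exists>g\<in>U. d g e \<le> \<delta>)"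
    if "geo q p S" "geo r p T \<or> geo p r T" "geo r q U \<or> geo q r U" "e \<in> S" for p q r S T U e
    using thin[of q p S r U T e] that by blast
qed

lemma dist_self: "x \<in> X \<Longrightarrow> d x x = 0"
  by (rule semimetric_self[OF semimetric])

lemma dist_trans:
  assumes "x \<in> X" "y \<in> X" "z \<in> X" "d x y \<le> K" "d y z \<le> L"
  shows "d x z \<le> K + L"
proof -
  have "d x z \<le> d x y + d y z" by (rule semimetric_triangle[OF semimetric assms(1-3)])
  then show ?thesis using add_mono[OF assms(4,5)] by simp
qed

text \<open>(B1) for extended nonnegative radii, with one function that bounds all finite distances.\<close>

lemma B1_bound:
  obtains F where "\<And>K. F K < top"
    "\<And>K x y z. \<lbrakk>K < top; x \<in> X; y \<in> X; z \<in> X; d x y \<le> K; d x z \<le> K; d y z < top\<rbrakk> \<Longrightarrow> d y z \<le> F K"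
proof -
  obtain f :: "real \<Rightarrow> real" where f: "\<And>x r y z. \<lbrakk>x \<in> X; r \<ge> 0; y \<in> out_ball X d r x; z \<in> out_ball X d r x\<rbrakk>
      \<Longrightarrow> d y z = \<infinity> \<or> d y z \<le> ennreal (f r)"
    using B1 unfolding B1_def by blast
  show thesis
  proof (rule that[of "\<lambda>K. ennreal (f (enn2real K))"])
    fix K x y z assume *: "K < top" "x \<in> X" "y \<in> X" "z \<in> X" "d x y \<le> K" "d x z \<le> K" "d y z < top"
    then show "d y z \<le> ennreal (f (enn2real K))"
      using f[of x "enn2real K" y z] by (auto simp: out_ball_def)
  qed simp
qed

lemma line_in: assumes "line geo R" "0 \<le> u" shows "R u \<in> X"
proof -
  have "geo (R u) (R (u+1)) (R ` {u..u+1}) \<or> geo (R (u+1)) (R u) (R ` {u..u+1})"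
    using assms unfolding line_def by simp
  then show ?thesis using geo_ends by blast
qed

lemma forward_line_finite:
  assumes "forward_line geo R" "0 \<le> s" "s \<le> t" shows "d (R s) (R t) < top"
proof (cases "s = t")
  case True
  then show ?thesis
    using dist_self[OF line_in[OF forward_line_imp_line[OF assms(1)] assms(2)]] by simp
next
  case False
  then show ?thesis using assms geo_ends unfolding forward_line_def
    by (metis order_le_less)
qed

lemma forward_line_mono:
  assumes "forward_line geo R" "0 \<le> s" "s \<le> u" "u \<le> t"
  shows "d (R s) (R u) \<le> d (R s) (R t)" "d (R u) (R t) \<le> d (R s) (R t)"
proof -
  have "d (R s) (R u) + d (R u) (R t) \<le> d (R s) (R t)"
  proof (cases "s = t")
    case True
    then show ?thesis
      using assms dist_self[OF line_in[OF forward_line_imp_line[OF assms(1)] assms(2)]] by simp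
  next
    case False
    then show ?thesis using assms unfolding forward_line_def
      by (intro geo_between[of _ _ "R ` {s..t}"]) auto
  qed
  then show "d (R s) (R u) \<le> d (R s) (R t)" "d (R u) (R t) \<le> d (R s) (R t)"
    by (rule ennreal_le_add_cancel)+
qed

lemma line_initial_bounded:
  assumes "line geo R" "0 \<le> n"
  obtains p K where "p \<in> X" "K < top" "\<And>u. 0 \<le> u \<Longrightarrow> u \<le> n \<Longrightarrow> d p (R u) \<le> K"
proof -
  obtain p q where g: "geo p q (R ` {0..n+1})"
    using assms unfolding line_def by (metis add_nonneg_pos less_numeral_extra(1) order_refl)
  show thesis
  proof (rule that[of p "d p q"])
    show "p \<in> X" "d p q < top" using geo_ends[OF g] by auto
    fix u assume "0 \<le> u" "u \<le> n"
    then have "R u \<in> R ` {0..n+1}" by simp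
    from geo_between[OF g this] show "d p (R u) \<le> d p q"
      by (rule ennreal_le_add_cancel)
  qed
qed

text \<open>It suffices to go far out on \<open>R2\<close>: an initial segment of \<open>R1\<close> lies in an out-ball, so its points
have bounded distance only to points of \<open>R2\<close> in a larger out-ball, which \<open>R2\<close> leaves.\<close>

lemma asymp_leI:
  assumes "line geo R1" "escapes_out_balls X d R2" "line geo R2" "M < top"
    and near: "\<And>n. \<exists>s\<ge>0. \<exists>t\<ge>n. d (R1 s) (R2 t) \<le> M"
  shows "asymp_le d R1 R2"
  unfolding asymp_le_def
proof (intro exI[of _ M] conjI allI \<open>M < top\<close>)
  fix n :: real
  obtain p K where p: "p \<in> X" "K < top" "\<And>u. 0 \<le> u \<Longrightarrow> u \<le> max n 0 \<Longrightarrow> d p (R1 u) \<le> K"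
    by (rule line_initial_bounded[OF assms(1), of "max n 0"]) auto
  obtain m where m: "\<And>t. t \<ge> m \<Longrightarrow> \<not> d p (R2 t) \<le> K + M"
    using assms(2) p(1,2) assms(4) unfolding escapes_out_balls_def by (metis ennreal_add_less_top)
  obtain s t where st: "s \<ge> 0" "t \<ge> max 0 (max m n)" "d (R1 s) (R2 t) \<le> M" using near by blast
  have "s \<ge> n"
  proof (rule ccontr)
    assume "\<not> s \<ge> n"
    then have "d p (R1 s) \<le> K" using p(3)[of s] st(1) by simp
    then have "d p (R2 t) \<le> K + M"
      using st line_in[OF assms(1), of s] line_in[OF assms(3), of t] p(1) by (intro dist_trans) auto
    then show False using m[of t] st(2) by simp
  qed
  then show "\<exists>s\<ge>n. \<exists>t\<ge>n. d (R1 s) (R2 t) \<le> M" using st by auto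
qed

text \<open>If some point \<open>R t0\<close> lies in the in-ball, then by (B2) all later points in it lie in one out-ball
around \<open>R t0\<close>.\<close>

lemma forward_line_escapes_in_balls:
  assumes "forward_line geo R" "escapes_out_balls X d R"
  shows "escapes_out_balls X (\<lambda>x y. d y x) R"
  unfolding escapes_out_balls_def
proof (intro ballI allI impI)
  interpret dual: directed_hyperbolic X "\<lambda>x y. d y x" "\<lambda>p q. geo q p" \<delta> by (rule dual)
  obtain F where F: "\<And>K. F K < top"
    "\<And>K x y z. \<lbrakk>K < top; x \<in> X; y \<in> X; z \<in> X; d y x \<le> K; d z x \<le> K; d z y < top\<rbrakk> \<Longrightarrow> d z y \<le> F K"
    using dual.B1_bound by blast
  have inX: "R u \<in> X" if "0 \<le> u" for u
    using line_in[OF forward_line_imp_line[OF assms(1)] that] .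
  fix x r assume x: "x \<in> X" and r: "r < (top::ennreal)"
  show "\<exists>p\<ge>0. \<forall>t\<ge>p. \<not> d (R t) x \<le> r"
  proof (cases "\<exists>t0\<ge>0. d (R t0) x \<le> r")
    case True
    then obtain t0 where t0: "t0 \<ge> 0" "d (R t0) x \<le> r" by blast
    obtain p where p: "\<And>t. t \<ge> p \<Longrightarrow> \<not> d (R t0) (R t) \<le> F r"
      using assms(2) inX[OF t0(1)] F(1) unfolding escapes_out_balls_def by blast
    have "\<not> d (R t) x \<le> r" if "t \<ge> max p t0" for t
      using p[of t] F(2)[of r x "R t" "R t0"] t0 inX x r that
        forward_line_finite[OF assms(1) t0(1), of t] by auto
    then show ?thesis using t0(1) by (intro exI[of _ "max p t0"]) auto
  next
    case False
    then show ?thesis by blast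
  qed
qed

text \<open>The diagonal \<open>D\<close> from \<open>R1 s\<close> to \<open>R2 t'\<close> is a side of two triangles: the one with third corner
\<open>R2 t\<close> yields the transition point \<open>a\<close> of \<open>D\<close>, from which \<open>R2 \<tau>\<close> can be reached, and the one with third
corner \<open>R1 s'\<close> leads from \<open>R1\<close> to \<open>a\<close>. The side on \<open>R1\<close> may point in either direction, as a triangle
is thin whatever the directions of its other two sides.\<close>

lemma forward_line_shadowed:
  assumes R1: "line geo R1" and R2: "forward_line geo R2" "escapes_out_balls X d R2"
    and le: "asymp_le d R1 R2"
  obtains K t\<^sub>0 where "K < top" "\<And>\<tau>. t\<^sub>0 \<le> \<tau> \<Longrightarrow> \<exists>\<sigma>\<ge>0. d (R1 \<sigma>) (R2 \<tau>) \<le> K"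
proof -
  obtain M where M: "M < top" "\<And>n. \<exists>s\<ge>n. \<exists>t\<ge>n. d (R1 s) (R2 t) \<le> M"
    using le unfolding asymp_le_def by blast
  obtain F where F: "\<And>K. F K < top"
    "\<And>K x y z. \<lbrakk>K < top; x \<in> X; y \<in> X; z \<in> X; d x y \<le> K; d x z \<le> K; d y z < top\<rbrakk> \<Longrightarrow> d y z \<le> F K"
    using B1_bound by blast
  have in1: "R1 u \<in> X" if "0 \<le> u" for u using line_in[OF R1 that] .
  have in2: "R2 u \<in> X" if "0 \<le> u" for u using line_in[OF forward_line_imp_line[OF R2(1)] that] .
  obtain s t where st: "s \<ge> 0" "t \<ge> 0" "d (R1 s) (R2 t) \<le> M" using M(2)[of 0] by blast
  obtain P where P: "geo (R1 s) (R2 t) P"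
    using geo_exists[OF in1[OF st(1)] in2[OF st(2)]] le_less_trans[OF st(3) M(1)] by blast
  \<comment> \<open>the bounds for a transition near the first connection and for one near \<open>R2\<close>\<close>
  define K\<^sub>1 where "K\<^sub>1 = M + F (M + \<delta> + 1 + \<delta>)"
  define K\<^sub>2 where "K\<^sub>2 = \<delta> + (\<delta> + F (1 + \<delta>))"
  have fin: "K\<^sub>1 + K\<^sub>2 < top" "M + \<delta> + 1 + \<delta> < top" "1 + \<delta> < top" "\<delta> + M < top"
    unfolding K\<^sub>1_def K\<^sub>2_def using M(1) F(1) delta_finite by (simp_all)
  have "\<exists>\<sigma>\<ge>0. d (R1 \<sigma>) (R2 \<tau>) \<le> K\<^sub>1 + K\<^sub>2" if \<tau>: "t \<le> \<tau>" for \<tau>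
  proof -
    have \<tau>0: "0 \<le> \<tau>" using \<tau> st by simp
    \<comment> \<open>the second connection must end so far out that it cannot end near \<open>R2 \<tau>\<close>\<close>
    obtain p where p: "\<And>u. u \<ge> p \<Longrightarrow> \<not> d (R2 \<tau>) (R2 u) \<le> F (\<delta> + M)"
      using R2(2) in2[OF \<tau>0] F(1) unfolding escapes_out_balls_def by blast
    obtain s' t' where st': "s' \<ge> s + 1" "t' \<ge> \<tau> + 1" "t' \<ge> p" "d (R1 s') (R2 t') \<le> M"
      using M(2)[of "max (s+1) (max (\<tau>+1) p)"] by auto
    have pos: "0 \<le> s'" "0 \<le> t'" "t < t'" "s < s'" using st st' \<tau> by auto
    note X = in1[OF st(1)] in1[OF pos(1)] in2[OF st(2)] in2[OF pos(2)] in2[OF \<tau>0]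
    obtain P' where P': "geo (R1 s') (R2 t') P'"
      using geo_exists[OF X(2,4)] le_less_trans[OF st'(4) M(1)] by blast
    have "d (R1 s) (R2 t') \<le> M + d (R2 t) (R2 t')" by (rule dist_trans) (use X st in auto)
    moreover have "M + d (R2 t) (R2 t') < top"
      using M(1) forward_line_finite[OF R2(1) st(2), of t'] pos by simp
    ultimately obtain D where D: "geo (R1 s) (R2 t') D"
      using geo_exists[OF X(1,4)] by (blast intro: order_le_less_trans)
    have DX: "D \<subseteq> X" using geo_ends[OF D] by blast
    have seg2: "geo (R2 t) (R2 t') (R2 ` {t..t'})"
      using R2(1) st(2) pos(3) unfolding forward_line_def by blast
    have seg1: "geo (R1 s) (R1 s') (R1 ` {s..s'}) \<or> geo (R1 s') (R1 s) (R1 ` {s..s'})"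
      using R1 st(1) pos(4) unfolding line_def by blast
    \<comment> \<open>\<open>A\<close>: near the first connection or reaching \<open>R2\<close> before \<open>\<tau>\<close>; \<open>B\<close>: reaching \<open>R2\<close> after \<open>\<tau>\<close>\<close>
    define A where "A = {e. (\<exists>g\<in>P. d g e \<le> \<delta>) \<or> (\<exists>u\<in>{t..\<tau>}. d e (R2 u) \<le> \<delta>)}"
    define B where "B = {e. \<exists>u\<in>{\<tau>..t'}. d e (R2 u) \<le> \<delta>}"
    have "R1 s \<in> A" unfolding A_def using geo_ends[OF P] dist_self[OF X(1)]
      by (intro CollectI disjI1 bexI[of _ "R1 s"]) auto
    moreover have "R2 t' \<in> B" unfolding B_def using dist_self[OF X(4)] st'(2)
      by (intro CollectI bexI[of _ t']) auto
    moreover have "D \<subseteq> A \<union> B"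
    proof
      fix e assume "e \<in> D"
      from thin[OF D disjI1[OF P] disjI2[OF seg2] this]
      consider "\<exists>g\<in>P. d g e \<le> \<delta>" | u where "u \<in> {t..t'}" "d e (R2 u) \<le> \<delta>" by blast
      then show "e \<in> A \<union> B"
      proof cases
        case 2
        then have "u \<in> {t..\<tau>} \<or> u \<in> {\<tau>..t'}" by auto
        then show ?thesis unfolding A_def B_def using 2(2) by blast
      qed (simp add: A_def)
    qed
    ultimately obtain a b where ab: "a \<in> A" "a \<in> D" "b \<in> B" "b \<in> D" "d a b \<le> 1"
      using geo_connected[OF D] by blast
    have abX: "a \<in> X" "b \<in> X" using ab DX by auto
    obtain v where v: "v \<in> {\<tau>..t'}" "d b (R2 v) \<le> \<delta>" using ab(3) unfolding B_def by blast
    have vX: "R2 v \<in> X" using v \<tau>0 by (intro in2) auto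
    have av: "d a (R2 v) \<le> 1 + \<delta>" by (rule dist_trans[OF abX vX ab(5) v(2)])
    from ab(1) consider g where "g \<in> P" "d g a \<le> \<delta>" | u where "u \<in> {t..\<tau>}" "d a (R2 u) \<le> \<delta>"
      unfolding A_def by blast
    then show ?thesis
    proof cases
      \<comment> \<open>the transition is near the first connection, so \<open>R1 s\<close> itself reaches \<open>R2 v\<close>; now (B1) at \<open>R1 s\<close>\<close>
      case 1
      have gX: "g \<in> X" using geo_ends[OF P] 1 by blast
      have "d (R1 s) g \<le> M"
        by (rule order_trans[OF ennreal_le_add_cancel(1)[OF geo_between[OF P 1(1)]] st(3)])
      then have "d (R1 s) a \<le> M + \<delta>" by (rule dist_trans[OF X(1) gX abX(1) _ 1(2)])
      from dist_trans[OF X(1) abX(1) vX this av]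
      have "d (R1 s) (R2 v) \<le> M + \<delta> + 1 + \<delta>" by (simp add: add.assoc)
      moreover have "d (R1 s) (R2 t) \<le> M + \<delta> + 1 + \<delta>"
        using st(3) by (simp add: add.assoc add_increasing2)
      ultimately have "d (R2 t) (R2 v) \<le> F (M + \<delta> + 1 + \<delta>)"
        using v \<tau> by (intro F(2)[OF fin(2) X(1,3) vX] forward_line_finite[OF R2(1) st(2)]) auto
      then have "d (R2 t) (R2 \<tau>) \<le> F (M + \<delta> + 1 + \<delta>)"
        using forward_line_mono(1)[OF R2(1) st(2) \<tau>, of v] v by auto
      from dist_trans[OF X(1,3,5) st(3) this] have "d (R1 s) (R2 \<tau>) \<le> K\<^sub>1" unfolding K\<^sub>1_def .
      then show ?thesis using st(1) by (blast intro: add_increasing2 zero_le)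
    next
      \<comment> \<open>\<open>a\<close> reaches \<open>R2\<close> on both sides of \<open>\<tau>\<close>; now (B1) at \<open>a\<close>, then the triangle with corner \<open>R1 s'\<close>\<close>
      case 2
      have u0: "0 \<le> u" "u \<le> \<tau>" using 2 st by auto
      have uX: "R2 u \<in> X" by (rule in2[OF u0(1)])
      have "d a (R2 u) \<le> 1 + \<delta>" using 2(2) by (simp add: add_increasing)
      then have "d (R2 u) (R2 v) \<le> F (1 + \<delta>)"
        using av u0 v by (intro F(2)[OF fin(3) abX(1) uX vX] forward_line_finite[OF R2(1)]) auto
      then have "d (R2 u) (R2 \<tau>) \<le> F (1 + \<delta>)"
        using forward_line_mono(1)[OF R2(1) u0, of v] v by auto
      then have a\<tau>: "d a (R2 \<tau>) \<le> \<delta> + F (1 + \<delta>)"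
        by (rule dist_trans[OF abX(1) uX X(5) 2(2)])
      from thin[OF D seg1 disjI2[OF P'] ab(2)]
      consider \<sigma> where "\<sigma> \<in> {s..s'}" "d (R1 \<sigma>) a \<le> \<delta>" | g where "g \<in> P'" "d a g \<le> \<delta>" by blast
      then show ?thesis
      proof cases
        case (1 \<sigma>)
        have "0 \<le> \<sigma>" using 1 st by auto
        from dist_trans[OF in1[OF this] abX(1) X(5) 1(2) a\<tau>]
        have "d (R1 \<sigma>) (R2 \<tau>) \<le> K\<^sub>2" unfolding K\<^sub>2_def .
        then show ?thesis using \<open>0 \<le> \<sigma>\<close> by (blast intro: add_increasing zero_le)
      next
        \<comment> \<open>impossible: \<open>a\<close> would be close to \<open>R2 t'\<close>, and by (B1) so would be \<open>R2 \<tau>\<close>\<close>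
        case (2 g)
        have gX: "g \<in> X" using geo_ends[OF P'] 2 by blast
        have "d g (R2 t') \<le> M"
          by (rule order_trans[OF ennreal_le_add_cancel(2)[OF geo_between[OF P' 2(1)]] st'(4)])
        from dist_trans[OF abX(1) gX X(4) 2(2) this] have "d a (R2 t') \<le> \<delta> + M" .
        moreover have "d a (R2 u) \<le> \<delta> + M"
          using \<open>d a (R2 u) \<le> \<delta>\<close> by (simp add: add_increasing2)
        ultimately have "d (R2 u) (R2 t') \<le> F (\<delta> + M)"
          using u0 st'(2) by (intro F(2)[OF fin(4) abX(1) uX X(4)] forward_line_finite[OF R2(1)]) auto
        then have "d (R2 \<tau>) (R2 t') \<le> F (\<delta> + M)"
          using forward_line_mono(2)[OF R2(1) u0, of t'] st'(2) by auto
        then show ?thesis using p[OF st'(3)] by blast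
      qed
    qed
  qed
  then show thesis using that fin(1) by blast
qed

lemma asymp_le_trans_forward:
  assumes R1: "line geo R1" and R2: "forward_line geo R2" "escapes_out_balls X d R2"
    and R3: "line geo R3" "escapes_out_balls X d R3"
    and le: "asymp_le d R1 R2" "asymp_le d R2 R3"
  shows "asymp_le d R1 R3"
proof -
  obtain K t0 where K: "K < top" "\<And>\<tau>. t0 \<le> \<tau> \<Longrightarrow> \<exists>\<sigma>\<ge>0. d (R1 \<sigma>) (R2 \<tau>) \<le> K"
    using forward_line_shadowed[OF R1 R2 le(1)] by blast
  obtain M where M: "M < top" "\<And>n. \<exists>s\<ge>n. \<exists>t\<ge>n. d (R2 s) (R3 t) \<le> M"
    using le(2) unfolding asymp_le_def by blast
  show ?thesis
  proof (rule asymp_leI[OF R1 R3(2,1)])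
    show "K + M < top" using K M by simp
    fix n
    obtain s t where st: "s \<ge> max 0 (max t0 n)" "t \<ge> max 0 (max t0 n)" "d (R2 s) (R3 t) \<le> M"
      using M(2) by blast
    obtain \<sigma> where \<sigma>: "\<sigma> \<ge> 0" "d (R1 \<sigma>) (R2 s) \<le> K" using K(2)[of s] st by auto
    have "d (R1 \<sigma>) (R3 t) \<le> K + M"
      using \<sigma> st by (intro dist_trans[of _ "R2 s"] line_in[OF R1] line_in[OF R3(1)]
          line_in[OF forward_line_imp_line[OF R2(1)]]) auto
    then show "\<exists>s\<ge>0. \<exists>t\<ge>n. d (R1 s) (R3 t) \<le> K + M" using \<sigma> st by auto
  qed
qed

text \<open>If \<open>R2\<close> is a backward line, the previous lemma applies to \<open>R3, R2, R1\<close> in the reversed space.\<close>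

lemma asymp_le_trans:
  assumes esc: "escaping_line X d geo R1" "escaping_line X d geo R2" "escaping_line X d geo R3"
    and le: "asymp_le d R1 R2" "asymp_le d R2 R3"
  shows "asymp_le d R1 R3"
proof -
  note l = esc[THEN escaping_line_imp_line]
  have out: "escapes_out_balls X d R2" "escapes_out_balls X d R3"
    and into: "escapes_out_balls X (\<lambda>x y. d y x) R1" "escapes_out_balls X (\<lambda>x y. d y x) R2"
    using esc unfolding escaping_line_def by blast+
  from esc(2) consider "forward_line geo R2" | "forward_line (\<lambda>p q. geo q p) R2"
    unfolding escaping_line_def by blast
  then show ?thesis
  proof cases
    case 1
    then show ?thesis by (rule asymp_le_trans_forward[OF l(1) _ out(1) l(3) out(2) le])
  next
    case 2
    interpret dual: directed_hyperbolic X "\<lambda>x y. d y x" "\<lambda>p q. geo q p" \<delta> by (rule dual)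
    from dual.asymp_le_trans_forward[OF _ 2 into(2) _ into(1), of R3] show ?thesis
      using l le unfolding asymp_le_flip[of d] line_flip[of geo] by blast
  qed
qed

lemma asymp_le_refl:
  assumes "line geo R" shows "asymp_le d R R"
  unfolding asymp_le_def
proof (intro exI[of _ "0 :: ennreal"] conjI allI)
  fix n :: real
  have "d (R (max n 0)) (R (max n 0)) \<le> 0"
    using dist_self[OF line_in[OF assms, of "max n 0"]] by simp
  then show "\<exists>s\<ge>n. \<exists>t\<ge>n. d (R s) (R t) \<le> 0" by (meson max.cobounded1)
qed simp

end

section \<open>Directed paths and their length\<close>

lemma real_semimetric_space: "semimetric_space I real_semimetric"
  unfolding semimetric_space_def
proof (intro conjI ballI)
  show "real_semimetric x y = 0 \<longleftrightarrow> x = y" for x y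
    by (auto simp: real_semimetric_def ennreal_eq_0_iff)
  show "real_semimetric x y \<le> real_semimetric x z + real_semimetric z y" for x y z
    by (auto simp: real_semimetric_def simp flip: ennreal_plus)
qed

lemma backward_topology_eq: "backward_topology X d = forward_topology X (\<lambda>x y. d y x)"
  by (simp add: forward_topology_def backward_topology_def)

lemma topspace_forward_topology:
  assumes "semimetric_space X d" shows "topspace (forward_topology X d) = X"
proof -
  have "x \<in> {y \<in> X. d x y < ennreal 1}" if "x \<in> X" for x
    using semimetric_self[OF assms that] that by simp
  then show ?thesis
    unfolding forward_topology_def topology_generated_by_topspace
    by (intro equalityI subsetI) (blast, use zero_less_one in blast)
qed

text \<open>For the semimetric of a set of reals, forward neighbourhoods are right neighbourhoods and
backward neighbourhoods are left neighbourhoods. So bicontinuity controls the distance from \<open>P c\<close> to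
the values just after \<open>c\<close> and from the values just before \<open>c\<close> to \<open>P c\<close>.\<close>

lemma openin_forward_real:
  assumes "openin (forward_topology I real_semimetric) U" "c \<in> U"
  obtains e where "0 < e" "\<And>s. s \<in> I \<Longrightarrow> c \<le> s \<Longrightarrow> s < c + e \<Longrightarrow> s \<in> U"
proof -
  have "generate_topology_on {{y \<in> I. real_semimetric x y < ennreal r} |x r. x \<in> I \<and> 0 < r} U"
    using assms(1) unfolding forward_topology_def openin_topology_generated_by_iff .
  then have "\<exists>e>0. \<forall>s\<in>I. c \<le> s \<and> s < c + e \<longrightarrow> s \<in> U"
    using assms(2)
  proof (induction rule: generate_topology_on.induct)
    case (Int a b)
    then obtain e1 e2 where "e1 > 0" "e2 > 0" "\<forall>s\<in>I. c \<le> s \<and> s < c + e1 \<longrightarrow> s \<in> a"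
      "\<forall>s\<in>I. c \<le> s \<and> s < c + e2 \<longrightarrow> s \<in> b" by blast
    then show ?case by (intro exI[of _ "min e1 e2"]) auto
  next
    case (UN K)
    then show ?case by (meson Union_iff)
  next
    case (Basis U)
    then obtain x r where U: "U = {y \<in> I. real_semimetric x y < ennreal r}" "x \<in> I" "0 < r" by blast
    from Basis U have "x \<le> c" "c - x < r"
      by (auto simp: real_semimetric_def ennreal_less_iff split: if_splits)
    then show ?case
      by (intro exI[of _ "r - (c - x)"]) (auto simp: U real_semimetric_def ennreal_less_iff)
  qed simp
  then show thesis using that by blast
qed

lemma openin_backward_real:
  assumes "openin (backward_topology I real_semimetric) U" "c \<in> U"
  obtains e where "0 < e" "\<And>s. s \<in> I \<Longrightarrow> s \<le> c \<Longrightarrow> c - e < s \<Longrightarrow> s \<in> U"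
proof -
  have "generate_topology_on {{y \<in> I. real_semimetric y x < ennreal r} |x r. x \<in> I \<and> 0 < r} U"
    using assms(1) unfolding backward_topology_def openin_topology_generated_by_iff .
  then have "\<exists>e>0. \<forall>s\<in>I. s \<le> c \<and> c - e < s \<longrightarrow> s \<in> U"
    using assms(2)
  proof (induction rule: generate_topology_on.induct)
    case (Int a b)
    then obtain e1 e2 where "e1 > 0" "e2 > 0" "\<forall>s\<in>I. s \<le> c \<and> c - e1 < s \<longrightarrow> s \<in> a"
      "\<forall>s\<in>I. s \<le> c \<and> c - e2 < s \<longrightarrow> s \<in> b" by blast
    then show ?case by (intro exI[of _ "min e1 e2"]) auto
  next
    case (UN K)
    then show ?case by (meson Union_iff)
  next
    case (Basis U)
    then obtain x r where U: "U = {y \<in> I. real_semimetric y x < ennreal r}" "x \<in> I" "0 < r" by blast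
    from Basis U have "c \<le> x" "x - c < r"
      by (auto simp: real_semimetric_def ennreal_less_iff split: if_splits)
    then show ?case
      by (intro exI[of _ "r - (x - c)"]) (auto simp: U real_semimetric_def ennreal_less_iff)
  qed simp
  then show thesis using that by blast
qed

lemma bicontinuous_on_in:
  assumes "semimetric_space X d" "bicontinuous_on X d I P" "c \<in> I"
  shows "P c \<in> X"
  using assms topspace_forward_topology[OF real_semimetric_space, of I]
    topspace_forward_topology[OF assms(1)]
  unfolding bicontinuous_on_def continuous_map_def by auto

lemma bicontinuous_on_right:
  assumes "semimetric_space X d" "bicontinuous_on X d I P" "c \<in> I" "0 < \<epsilon>"
  obtains e where "0 < e" "\<And>s. s \<in> I \<Longrightarrow> c \<le> s \<Longrightarrow> s < c + e \<Longrightarrow> d (P c) (P s) < ennreal \<epsilon>"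
proof -
  have Pc: "P c \<in> X" by (rule bicontinuous_on_in[OF assms(1-3)])
  let ?B = "{y \<in> X. d (P c) y < ennreal \<epsilon>}"
  have "openin (forward_topology X d) ?B"
    unfolding forward_topology_def by (rule topology_generated_by_Basis) (use Pc assms(4) in blast)
  with assms(2) have "openin (forward_topology I real_semimetric)
      {x \<in> topspace (forward_topology I real_semimetric). P x \<in> ?B}"
    unfolding bicontinuous_on_def by (blast intro: openin_continuous_map_preimage)
  then have *: "openin (forward_topology I real_semimetric) {x \<in> I. P x \<in> ?B}"
    by (simp only: topspace_forward_topology[OF real_semimetric_space])
  have cB: "c \<in> {x \<in> I. P x \<in> ?B}"
    using Pc assms(3,4) semimetric_self[OF assms(1) Pc] by simp
  show thesis
    by (rule openin_forward_real[OF * cB]) (rule that, auto)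
qed

lemma bicontinuous_on_left:
  assumes "semimetric_space X d" "bicontinuous_on X d I P" "c \<in> I" "0 < \<epsilon>"
  obtains e where "0 < e" "\<And>s. s \<in> I \<Longrightarrow> s \<le> c \<Longrightarrow> c - e < s \<Longrightarrow> d (P s) (P c) < ennreal \<epsilon>"
proof -
  have Pc: "P c \<in> X" by (rule bicontinuous_on_in[OF assms(1-3)])
  let ?B = "{y \<in> X. d y (P c) < ennreal \<epsilon>}"
  have "openin (backward_topology X d) ?B"
    unfolding backward_topology_def by (rule topology_generated_by_Basis) (use Pc assms(4) in blast)
  with assms(2) have "openin (backward_topology I real_semimetric)
      {x \<in> topspace (backward_topology I real_semimetric). P x \<in> ?B}"
    unfolding bicontinuous_on_def by (blast intro: openin_continuous_map_preimage)
  then have *: "openin (backward_topology I real_semimetric) {x \<in> I. P x \<in> ?B}"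
    by (simp only: backward_topology_eq
        topspace_forward_topology[OF semimetric_space_flip[OF real_semimetric_space]])
  have cB: "c \<in> {x \<in> I. P x \<in> ?B}"
    using Pc assms(3,4) semimetric_self[OF assms(1) Pc] by simp
  show thesis
    by (rule openin_backward_real[OF * cB]) (rule that, auto)
qed

lemma directed_path_in:
  assumes "semimetric_space X d" "directed_path X d P"
  shows "dpath_image P \<subseteq> X"
  using bicontinuous_on_in[OF assms(1)] assms(2) unfolding directed_path_def dpath_image_def by blast

lemma directed_path_ends:
  assumes "directed_path X d P"
  shows "start_point P \<in> dpath_image P" "end_point P \<in> dpath_image P"
  using assms unfolding directed_path_def dpath_image_def start_point_def end_point_def by auto

text \<open>Let \<open>c\<close> be the supremum of the parameters of points in \<open>A\<close>. If \<open>P c\<close> is in \<open>A\<close>, a point just after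
it is in \<open>B\<close>, and forward continuity at \<open>c\<close> applies; otherwise \<open>P c\<close> is in \<open>B\<close>, a point just before
it is in \<open>A\<close>, and backward continuity at \<open>c\<close> applies.\<close>

lemma directed_path_cover:
  assumes sm: "semimetric_space X d" and P: "directed_path X d P"
    and A: "start_point P \<in> A" and B: "end_point P \<in> B" and cover: "dpath_image P \<subseteq> A \<union> B"
  shows "\<exists>a\<in>A \<inter> dpath_image P. \<exists>b\<in>B \<inter> dpath_image P. d a b \<le> 1"
proof -
  define p where "p = map_of_path P"
  define I where "I = {lower P..upper P}"
  have lu: "lower P < upper P" and cont: "bicontinuous_on X d I p"
    using P unfolding directed_path_def p_def I_def by auto
  have im: "dpath_image P = p ` I" unfolding dpath_image_def p_def I_def ..
  define T where "T = {t \<in> I. p t \<in> A}"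
  define c where "c = Sup T"
  have T: "lower P \<in> T" "bdd_above T"
    using A lu unfolding T_def I_def p_def start_point_def by auto
  have c: "lower P \<le> c" "c \<le> upper P"
    unfolding c_def using T by (auto intro!: cSup_upper cSup_least simp: T_def I_def)
  then have cI: "c \<in> I" by (simp add: I_def)
  have close: ?thesis if "s \<in> I" "t \<in> I" "p s \<in> A" "p t \<in> B" "d (p s) (p t) \<le> 1" for s t
    using that unfolding im by blast
  show ?thesis
  proof (cases "p c \<in> A")
    case True
    show ?thesis
    proof (cases "c = upper P")
      case True
      then have "p c \<in> B" using B unfolding p_def end_point_def by simp
      moreover have "d (p c) (p c) = 0"
        by (rule semimetric_self[OF sm bicontinuous_on_in[OF sm cont cI]])
      ultimately show ?thesis using close[of c c] cI \<open>p c \<in> A\<close> by simp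
    next
      case False
      then have "c < upper P" using c by simp
      obtain e where e: "0 < e" "\<And>s. s \<in> I \<Longrightarrow> c \<le> s \<Longrightarrow> s < c + e \<Longrightarrow> d (p c) (p s) < ennreal 1"
        using bicontinuous_on_right[OF sm cont cI zero_less_one] by blast
      obtain s where s: "c < s" "s < min (c + e) (upper P)"
        using dense[of c "min (c + e) (upper P)"] e(1) \<open>c < upper P\<close> by auto
      have sI: "s \<in> I" using s c by (auto simp: I_def)
      have "s \<notin> T" using s(1) cSup_upper[OF _ T(2)] unfolding c_def by force
      then have "p s \<in> B" using sI cover unfolding T_def im by blast
      then show ?thesis using close[of c s] cI sI True e(2)[OF sI] s by (simp add: less_imp_le)
    qed
  next
    case False
    then have "p c \<in> B" using cI cover unfolding im by blast
    obtain e where e: "0 < e" "\<And>s. s \<in> I \<Longrightarrow> s \<le> c \<Longrightarrow> c - e < s \<Longrightarrow> d (p s) (p c) < ennreal 1"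
      using bicontinuous_on_left[OF sm cont cI zero_less_one] by blast
    obtain s where s: "s \<in> T" "c - e < s"
      using less_cSupD[of T "c - e"] T(1) e(1) unfolding c_def by auto
    have "s \<le> c" unfolding c_def using cSup_upper[OF s(1) T(2)] .
    then show ?thesis using close[of s c] cI s e(2)[of s] \<open>p c \<in> B\<close> unfolding T_def
      by (simp add: less_imp_le)
  qed
qed

text \<open>A step of length at most \<open>1\<close> cannot lead from the points at finite distance from the start to the
others.\<close>

lemma directed_path_finite:
  assumes sm: "semimetric_space X d" and P: "directed_path X d P"
  shows "d (start_point P) (end_point P) < top"
proof (rule ccontr)
  let ?x = "start_point P"
  assume "\<not> d ?x (end_point P) < top"
  moreover have X: "?x \<in> X" "dpath_image P \<subseteq> X"
    using directed_path_in[OF assms] directed_path_ends[OF P] by auto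
  moreover have "d ?x ?x = 0" by (rule semimetric_self[OF sm X(1)])
  ultimately obtain a b where ab: "a \<in> X" "b \<in> X" "d ?x a < top" "\<not> d ?x b < top" "d a b \<le> 1"
    using directed_path_cover[OF sm P, of "{e. d ?x e < top}" "{e. \<not> d ?x e < top}"] by auto
  have "d ?x b \<le> d ?x a + d a b" by (rule semimetric_triangle[OF sm X(1) ab(1,2)])
  also have "\<dots> < top" using ab(3,5) by (simp add: order_le_less_trans)
  finally show False using ab(4) by simp
qed

lemma semimetric_chain:
  assumes sm: "semimetric_space X d" and "j \<le> k" "\<And>i. i \<le> k \<Longrightarrow> x i \<in> X"
  shows "d (x j) (x k) \<le> (\<Sum>i=Suc j..k. d (x (i - 1)) (x i))"
  using assms(2,3)
proof (induction k rule: dec_induct)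
  case base
  then show ?case using semimetric_self[OF sm] by simp
next
  case (step n)
  have "d (x j) (x (Suc n)) \<le> d (x j) (x n) + d (x n) (x (Suc n))"
    using step by (intro semimetric_triangle[OF sm]) auto
  also have "\<dots> \<le> (\<Sum>i=Suc j..n. d (x (i - 1)) (x i)) + d (x n) (x (Suc n))"
    using step by (intro add_right_mono step.IH) auto
  also have "\<dots> = (\<Sum>i=Suc j..Suc n. d (x (i - 1)) (x i))"
    using step(1) by (simp add: sum.nat_ivl_Suc')
  finally show ?case .
qed

text \<open>For a geodesic the length is the distance of the ends, so equality holds: its points lie metrically
between the ends. The point \<open>e = P c\<close> need not be on the grid of the \<open>N\<close>-th sum. The grid points next
to \<open>c\<close> are \<open>t N j \<le> c \<le> t N k\<close>; for large \<open>N\<close>, backward continuity makes the distance from \<open>P (t N j)\<close>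
to \<open>e\<close> small, and forward continuity the one from \<open>e\<close> to \<open>P (t N k)\<close>. The sum bounds the
distances from the start to \<open>P (t N j)\<close> and from \<open>P (t N k)\<close> to the end.\<close>

lemma has_length_ge:
  assumes sm: "semimetric_space X d" and P: "directed_path X d P" and l: "has_length d P l"
    and e: "e \<in> dpath_image P"
  shows "d (start_point P) e + d e (end_point P) \<le> l"
proof (rule ennreal_le_epsilon)
  fix \<epsilon> :: real assume "0 < \<epsilon>"
  define p where "p = map_of_path P"
  define I where "I = {lower P..upper P}"
  define L where "L = upper P - lower P"
  have cont: "bicontinuous_on X d I p" and L: "0 < L"
    using P unfolding directed_path_def p_def I_def L_def by auto
  obtain c where cI: "c \<in> I" and c: "e = p c" using e unfolding dpath_image_def I_def p_def by blast
  have ab: "start_point P = p (lower P)" "end_point P = p (upper P)"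
    unfolding start_point_def end_point_def p_def by auto
  obtain e1 where e1: "0 < e1" "\<And>s. s \<in> I \<Longrightarrow> c \<le> s \<Longrightarrow> s < c + e1 \<Longrightarrow> d (p c) (p s) < ennreal (\<epsilon>/2)"
    using bicontinuous_on_right[OF sm cont cI, of "\<epsilon>/2"] \<open>0 < \<epsilon>\<close> by auto
  obtain e2 where e2: "0 < e2" "\<And>s. s \<in> I \<Longrightarrow> s \<le> c \<Longrightarrow> c - e2 < s \<Longrightarrow> d (p s) (p c) < ennreal (\<epsilon>/2)"
    using bicontinuous_on_left[OF sm cont cI, of "\<epsilon>/2"] \<open>0 < \<epsilon>\<close> by auto
  define t where "t N i = lower P + real i * L / real N" for N i :: nat
  define S where "S N = (\<Sum>i=1..N. d (p (t N (i - 1))) (p (t N i)))" for N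
  have lim: "S \<longlonglongrightarrow> l"
    using l unfolding has_length_def S_def t_def p_def L_def Let_def by simp
  have "d (p (lower P)) (p c) + d (p c) (p (upper P)) \<le> S N + ennreal \<epsilon>"
    if N: "N > nat \<lceil>L / min e1 e2\<rceil>" for N
  proof -
    have N0: "0 < real N" using N by simp
    have small: "L / N < e1" "L / N < e2"
    proof -
      have "L / min e1 e2 < N" using N by linarith
      then have "L / N < min e1 e2" using N0 e1(1) e2(1)
        by (metis divide_less_eq min_less_iff_conj mult.commute)
      then show "L / N < e1" "L / N < e2" by (simp_all only: min_less_iff_conj)
    qed
    \<comment> \<open>the position of \<open>c\<close> in units of the grid\<close>
    define u where "u = (c - lower P) * N / L"
    have u: "0 \<le> u" "u \<le> N" and cu: "c = lower P + u * L / N"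
      unfolding u_def using cI L N0 by (auto simp: I_def L_def divide_simps)
    define j k where "j = nat \<lfloor>u\<rfloor>" and "k = nat \<lceil>u\<rceil>"
    have jk: "real j \<le> u" "u < real j + 1" "u \<le> real k" "real k < u + 1" "j \<le> k" "k \<le> N"
      unfolding j_def k_def using u by linarith+
    have tI: "t N i \<in> I" if "i \<le> N" for i
    proof -
      have "real i * L \<le> real N * L" using that L by (intro mult_right_mono) auto
      then have "real i * L / N \<le> L" using N0 by (simp add: divide_simps mult.commute)
      then show ?thesis using L N0 unfolding t_def I_def L_def by (simp add: L_def)
    qed
    have inX: "p (t N i) \<in> X" if "i \<le> N" for i
      by (rule bicontinuous_on_in[OF sm cont tI[OF that]])
    have pX: "p c \<in> X" by (rule bicontinuous_on_in[OF sm cont cI])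
    have t0: "t N 0 = lower P" "t N N = upper P" using N0 unfolding t_def L_def by auto
    have diff: "c - t N j = (u - j) * (L / N)" "t N k - c = (k - u) * (L / N)"
      unfolding cu t_def by (simp_all add: algebra_simps diff_divide_distrib)
    have h: "0 \<le> L / N" using L N0 by simp
    have "0 \<le> c - t N j" "0 \<le> t N k - c"
      unfolding diff using jk by (intro mult_nonneg_nonneg h; simp)+
    moreover have "c - t N j \<le> 1 * (L / N)" "t N k - c \<le> 1 * (L / N)"
      unfolding diff using jk by (intro mult_right_mono h; simp)+
    ultimately have "t N j \<le> c" "c - e2 < t N j" "c \<le> t N k" "t N k < c + e1"
      using small by linarith+
    then have dj: "d (p (t N j)) (p c) \<le> ennreal (\<epsilon>/2)" and dk: "d (p c) (p (t N k)) \<le> ennreal (\<epsilon>/2)"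
      using jk tI by (auto intro!: less_imp_le e1(2) e2(2))
    have "d (p (lower P)) (p c) \<le> d (p (lower P)) (p (t N j)) + d (p (t N j)) (p c)"
      using pX inX[of 0] inX[of j] jk t0 by (intro semimetric_triangle[OF sm]) auto
    also have "\<dots> \<le> (\<Sum>i=Suc 0..j. d (p (t N (i - 1))) (p (t N i))) + ennreal (\<epsilon>/2)"
      using semimetric_chain[OF sm, of 0 j "\<lambda>i. p (t N i)"] inX jk t0 dj by (intro add_mono) auto
    finally have 1: "d (p (lower P)) (p c) \<le> \<dots>" .
    have "d (p c) (p (upper P)) \<le> d (p c) (p (t N k)) + d (p (t N k)) (p (upper P))"
      using pX inX[of N] inX[of k] jk t0 by (intro semimetric_triangle[OF sm]) auto
    also have "\<dots> \<le> ennreal (\<epsilon>/2) + (\<Sum>i=Suc k..N. d (p (t N (i - 1))) (p (t N i)))"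
      using semimetric_chain[OF sm, of k N "\<lambda>i. p (t N i)"] inX jk t0 dk by (intro add_mono) auto
    finally have 2: "d (p c) (p (upper P)) \<le> \<dots>" .
    have "(\<Sum>i=Suc 0..j. d (p (t N (i - 1))) (p (t N i))) + (\<Sum>i=Suc k..N. d (p (t N (i - 1))) (p (t N i)))
        = (\<Sum>i\<in>{Suc 0..j} \<union> {Suc k..N}. d (p (t N (i - 1))) (p (t N i)))"
      using jk by (intro sum.union_disjoint[symmetric]) auto
    also have "\<dots> \<le> S N" unfolding S_def using jk by (intro sum_mono2) auto
    finally have 3: "(\<Sum>i=Suc 0..j. d (p (t N (i - 1))) (p (t N i))) +
      (\<Sum>i=Suc k..N. d (p (t N (i - 1))) (p (t N i))) \<le> S N" .
    have "d (p (lower P)) (p c) + d (p c) (p (upper P)) \<le>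
       ((\<Sum>i=Suc 0..j. d (p (t N (i - 1))) (p (t N i))) + (\<Sum>i=Suc k..N. d (p (t N (i - 1))) (p (t N i))))
         + (ennreal (\<epsilon>/2) + ennreal (\<epsilon>/2))"
      using add_mono[OF 1 2] by (simp add: ac_simps)
    also have "\<dots> \<le> S N + ennreal \<epsilon>"
      using 3 \<open>0 < \<epsilon>\<close> by (intro add_mono) (auto simp flip: ennreal_plus)
    finally show ?thesis .
  qed
  then have "\<forall>\<^sub>F N in sequentially. d (p (lower P)) (p c) + d (p c) (p (upper P)) \<le> S N + ennreal \<epsilon>"
    by (auto simp: eventually_at_top_dense)
  moreover have "(\<lambda>N. S N + ennreal \<epsilon>) \<longlonglongrightarrow> l + ennreal \<epsilon>"
    by (intro tendsto_add lim tendsto_const)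
  ultimately show "d (start_point P) e + d e (end_point P) \<le> l + ennreal \<epsilon>"
    unfolding ab c by (intro tendsto_lowerbound) auto
qed

section \<open>Rays and anti-rays as lines\<close>

definition geodesic_image :: "'a set \<Rightarrow> ('a \<Rightarrow> 'a \<Rightarrow> ennreal) \<Rightarrow> 'a \<Rightarrow> 'a \<Rightarrow> 'a set \<Rightarrow> bool" where
  "geodesic_image X d p q S \<longleftrightarrow>
     (\<exists>P. geodesic X d P \<and> start_point P = p \<and> end_point P = q \<and> dpath_image P = S)"

lemma hyperbolic_imp_directed_hyperbolic:
  assumes sm: "semimetric_space X d" and gs: "geodesic_space X d"
    and \<delta>: "delta_hyperbolic X d \<delta>" and "B1 X d" "B2 X d"
  shows "directed_hyperbolic X d (geodesic_image X d) (ennreal \<delta>)"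
proof (unfold_locales)
  show "semimetric_space X d" "B1 X d" "B2 X d" "ennreal \<delta> < top" using assms by auto
  show ends: "p \<in> S \<and> q \<in> S \<and> S \<subseteq> X \<and> d p q < top" if "geodesic_image X d p q S" for p q S
    using that directed_path_in[OF sm] directed_path_ends directed_path_finite[OF sm]
    unfolding geodesic_image_def geodesic_def by blast
  show "d p e + d e q \<le> d p q" if "geodesic_image X d p q S" "e \<in> S" for p q S e
    using that has_length_ge[OF sm] unfolding geodesic_image_def geodesic_def by blast
  show "\<exists>S. geodesic_image X d p q S" if "p \<in> X" "q \<in> X" "d p q < top" for p q
    using that gs unfolding geodesic_image_def geodesic_space_def by fastforce
  show "\<exists>a\<in>A \<inter> S. \<exists>b\<in>B \<inter> S. d a b \<le> 1"
    if "geodesic_image X d p q S" "p \<in> A" "q \<in> B" "S \<subseteq> A \<union> B" for p q S A B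
    using that directed_path_cover[OF sm] unfolding geodesic_image_def geodesic_def by blast
  show "(\<exists>g\<in>T. d g e \<le> ennreal \<delta>) \<or> (\<exists>g\<in>U. d e g \<le> ennreal \<delta>)"
    if g: "geodesic_image X d p q S" "geodesic_image X d p r T \<or> geodesic_image X d r p T"
      "geodesic_image X d q r U \<or> geodesic_image X d r q U" and e: "e \<in> S" for p q r S T U e
  proof -
    obtain P where P: "geodesic X d P" "start_point P = p" "end_point P = q" "dpath_image P = S"
      using g(1) unfolding geodesic_image_def by blast
    obtain Q where Q: "geodesic_between X d p r Q" "dpath_image Q = T"
      using g(2) unfolding geodesic_image_def geodesic_between_def by blast
    obtain R where R: "geodesic_between X d q r R" "dpath_image R = U"
      using g(3) unfolding geodesic_image_def geodesic_between_def by blast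
    have "p \<in> X" "q \<in> X" "r \<in> X" using ends g by blast+
    then have "geodesic_triangle X d p q r P R Q"
      using P Q R unfolding geodesic_triangle_def geodesic_between_def by blast
    then have "thin_sides X d \<delta> P R Q" using \<delta> unfolding delta_hyperbolic_def by blast
    moreover have "{#P, Q, R#} = {#P, R, Q#}" by simp
    moreover have "start_point P \<in> {start_point Q, end_point Q}" "end_point P \<in> {start_point R, end_point R}"
      using P Q R unfolding geodesic_between_def by auto
    ultimately have "S \<subseteq> out_ball_set X d \<delta> T \<union> in_ball_set X d \<delta> U"
      unfolding thin_sides_def using P Q R by blast
    then show ?thesis using e unfolding out_ball_set_def in_ball_set_def out_ball_def in_ball_def by blast
  qed
qed

primrec outward :: "'a gen_ray \<Rightarrow> real \<Rightarrow> 'a" where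
  "outward (Ray R) = R"
| "outward (Antiray R) = (\<lambda>t. R (- t))"

lemma gen_ray_image_outward: "gen_ray_image R = outward R ` {0..}"
proof (cases R)
  case (Antiray S)
  have "S ` {..0} = S ` uminus ` {0..}" by simp
  also have "\<dots> = (\<lambda>t. S (- t)) ` {0..}" by (simp only: image_image)
  finally show ?thesis using Antiray by simp
qed simp

lemma is_ray_escapes:
  assumes "is_ray X d R" "semimetric_space X d" shows "escapes_out_balls X d R"
  unfolding escapes_out_balls_def
proof (intro ballI allI impI)
  fix x r assume x: "x \<in> X" and r: "r < (top::ennreal)"
  obtain p where p: "p \<ge> 0" "R ` {p..} \<inter> out_ball X d (enn2real r) x = {}"
    using assms x unfolding is_ray_def by (meson enn2real_nonneg)
  have "\<not> d x (R t) \<le> r" if "t \<ge> p" for t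
  proof -
    have "R t \<in> X" using bicontinuous_on_in[OF assms(2)] assms(1) that p(1) unfolding is_ray_def by force
    moreover have "R t \<notin> out_ball X d (enn2real r) x" using p(2) that by blast
    ultimately show ?thesis using r by (simp add: out_ball_def)
  qed
  then show "\<exists>p\<ge>0. \<forall>t\<ge>p. \<not> d x (R t) \<le> r" using p(1) by blast
qed

lemma is_antiray_escapes:
  assumes "is_antiray X d R" "semimetric_space X d"
  shows "escapes_out_balls X (\<lambda>x y. d y x) (\<lambda>t. R (- t))"
  unfolding escapes_out_balls_def
proof (intro ballI allI impI)
  fix x r assume x: "x \<in> X" and r: "r < (top::ennreal)"
  obtain p where p: "p \<le> 0" "R ` {..p} \<inter> in_ball X d (enn2real r) x = {}"
    using assms x unfolding is_antiray_def by (meson enn2real_nonneg)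
  have "\<not> d (R (- t)) x \<le> r" if "t \<ge> - p" for t
  proof -
    have "R (- t) \<in> X"
      using bicontinuous_on_in[OF assms(2)] assms(1) that p(1) unfolding is_antiray_def by force
    moreover have "- t \<in> {..p}" using that by simp
    then have "R (- t) \<notin> in_ball X d (enn2real r) x" using p(2) by blast
    ultimately show ?thesis using r by (simp add: in_ball_def)
  qed
  then show "\<exists>p\<ge>0. \<forall>t\<ge>p. \<not> d (R (- t)) x \<le> r" using p(1) by (intro exI[of _ "- p"]) auto
qed

lemma geodesic_ray_forward_line:
  assumes "geodesic_ray X d R" shows "forward_line (geodesic_image X d) R"
  unfolding forward_line_def geodesic_image_def
proof (intro allI impI)
  fix s t :: real assume "0 \<le> s \<and> s < t"
  then show "\<exists>P. geodesic X d P \<and> start_point P = R s \<and> end_point P = R t \<and> dpath_image P = R ` {s..t}"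
    using assms unfolding geodesic_ray_def
    by (intro exI[of _ "DPath s t R"]) (auto simp: start_point_def end_point_def dpath_image_def)
qed

lemma geodesic_antiray_forward_line:
  assumes "geodesic_antiray X d R" shows "forward_line (\<lambda>p q. geodesic_image X d q p) (\<lambda>t. R (- t))"
  unfolding forward_line_def geodesic_image_def
proof (intro allI impI)
  fix s t :: real assume st: "0 \<le> s \<and> s < t"
  have "(\<lambda>t. R (- t)) ` {s..t} = R ` uminus ` {s..t}" by (simp only: image_image)
  then have "(\<lambda>t. R (- t)) ` {s..t} = R ` {-t..-s}" by simp
  then show "\<exists>P. geodesic X d P \<and> start_point P = R (- t) \<and> end_point P = R (- s) \<and>
      dpath_image P = (\<lambda>t. R (- t)) ` {s..t}"
    using assms st unfolding geodesic_antiray_def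
    by (intro exI[of _ "DPath (- t) (- s) R"]) (auto simp: start_point_def end_point_def dpath_image_def)
qed

text \<open>The definition of a ray gives out-balls only, that of an anti-ray in-balls only; the balls of the
other kind come from (B2) and (B1), respectively.\<close>

lemma outward_escaping_line:
  assumes sm: "semimetric_space X d" and hyp: "directed_hyperbolic X d (geodesic_image X d) \<delta>"
    and R: "R \<in> geodesic_rays_antirays X d"
  shows "escaping_line X d (geodesic_image X d) (outward R)"
proof -
  interpret directed_hyperbolic X d "geodesic_image X d" \<delta> by (rule hyp)
  interpret dual: directed_hyperbolic X "\<lambda>x y. d y x" "\<lambda>p q. geodesic_image X d q p" \<delta> by (rule dual)
  from R consider S where "R = Ray S" "geodesic_ray X d S" | S where "R = Antiray S" "geodesic_antiray X d S"
    unfolding geodesic_rays_antirays_def by blast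
  then show ?thesis
  proof cases
    case (1 S)
    then show ?thesis
      using geodesic_ray_forward_line[OF 1(2)] is_ray_escapes[OF _ sm, of S]
        forward_line_escapes_in_balls[of S]
      unfolding escaping_line_def geodesic_ray_def by simp
  next
    case (2 S)
    then show ?thesis
      using geodesic_antiray_forward_line[OF 2(2)] is_antiray_escapes[OF _ sm, of S]
        dual.forward_line_escapes_in_balls[of "\<lambda>t. S (- t)"]
      unfolding escaping_line_def geodesic_antiray_def by simp
  qed
qed

text \<open>From left to right, the ball to be avoided is chosen to contain a long initial segment of \<open>R2\<close>. From
right to left, a geodesic of length at most \<open>M\<close> that meets the out-ball ends in the out-ball enlarged by
\<open>M\<close>, and one that meets the in-ball starts in the enlarged in-ball; both are excluded far out.\<close>

lemma ray_le_iff_asymp_le: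
  assumes sm: "semimetric_space X d" and gs: "geodesic_space X d"
    and hyp: "directed_hyperbolic X d (geodesic_image X d) \<delta>"
    and R: "R1 \<in> geodesic_rays_antirays X d" "R2 \<in> geodesic_rays_antirays X d"
  shows "ray_le X d R1 R2 \<longleftrightarrow> asymp_le d (outward R1) (outward R2)"
proof
  interpret directed_hyperbolic X d "geodesic_image X d" \<delta> by (rule hyp)
  let ?r1 = "outward R1" and ?r2 = "outward R2"
  have e: "escaping_line X d (geodesic_image X d) ?r1" "escaping_line X d (geodesic_image X d) ?r2"
    using outward_escaping_line[OF sm hyp] R by auto
  note l = escaping_line_imp_line[OF e(1)] escaping_line_imp_line[OF e(2)]
  {
    assume "ray_le X d R1 R2"
    then obtain M where M: "\<And>r x. r \<ge> 0 \<Longrightarrow> x \<in> X \<Longrightarrow> \<exists>P l. directed_path X d P \<and>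
        start_point P \<in> gen_ray_image R1 \<and> end_point P \<in> gen_ray_image R2 \<and>
        has_length d P l \<and> l \<le> ennreal M \<and> dpath_image P \<inter> (out_ball X d r x \<union> in_ball X d r x) = {}"
      unfolding ray_le_def by metis
    show "asymp_le d ?r1 ?r2"
    proof (rule asymp_leI[OF l(1) _ l(2)])
      show "escapes_out_balls X d ?r2" using e(2) unfolding escaping_line_def by blast
      show "ennreal M < top" by simp
      fix n
      obtain x K where x: "x \<in> X" "K < top" "\<And>u. 0 \<le> u \<Longrightarrow> u \<le> max n 0 \<Longrightarrow> d x (?r2 u) \<le> K"
        by (rule line_initial_bounded[OF l(2), of "max n 0"]) auto
      obtain P len where P: "directed_path X d P" "start_point P \<in> gen_ray_image R1"
        "end_point P \<in> gen_ray_image R2" "has_length d P len" "len \<le> ennreal M"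
        "dpath_image P \<inter> out_ball X d (enn2real K) x = {}"
        using M[of "enn2real K" x] x(1) by auto
      obtain s t where st: "s \<ge> 0" "start_point P = ?r1 s" "t \<ge> 0" "end_point P = ?r2 t"
        using P(2,3) unfolding gen_ray_image_outward by auto
      have "d (?r1 s) (?r2 t) \<le> ennreal M"
        using has_length_ge[OF sm P(1,4) directed_path_ends(2)[OF P(1)]] P(5) st
        by (auto dest: ennreal_le_add_cancel)
      moreover have "t \<ge> n"
      proof (rule ccontr)
        assume "\<not> t \<ge> n"
        then have "end_point P \<in> out_ball X d (enn2real K) x"
          using x(2) x(3)[of t] st line_in[OF l(2), of t] by (auto simp: out_ball_def)
        then show False using P(6) directed_path_ends(2)[OF P(1)] by blast
      qed
      ultimately show "\<exists>s\<ge>0. \<exists>t\<ge>n. d (?r1 s) (?r2 t) \<le> ennreal M" using st by blast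
    qed
  next
    assume "asymp_le d ?r1 ?r2"
    then obtain M where M: "M < top" "\<And>n. \<exists>s\<ge>n. \<exists>t\<ge>n. d (?r1 s) (?r2 t) \<le> M"
      unfolding asymp_le_def by blast
    show "ray_le X d R1 R2"
      unfolding ray_le_def
    proof (intro exI[of _ "enn2real M"] conjI allI impI ballI)
      fix r x assume r: "(r::real) \<ge> 0" and x: "x \<in> X"
      have fin: "ennreal r + M < top" "M + ennreal r < top" using M(1) by auto
      obtain n1 where n1: "\<And>t. t \<ge> n1 \<Longrightarrow> \<not> d x (?r2 t) \<le> ennreal r + M"
        using e(2) x fin unfolding escaping_line_def escapes_out_balls_def by blast
      obtain n2 where n2: "\<And>t. t \<ge> n2 \<Longrightarrow> \<not> d (?r1 t) x \<le> M + ennreal r"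
        using e(1) x fin unfolding escaping_line_def escapes_out_balls_def by blast
      obtain s t where st: "s \<ge> max 0 (max n1 n2)" "t \<ge> max 0 (max n1 n2)" "d (?r1 s) (?r2 t) \<le> M"
        using M(2) by blast
      have X: "?r1 s \<in> X" "?r2 t \<in> X" using st line_in[OF l(1)] line_in[OF l(2)] by auto
      obtain P where P: "geodesic X d P" "start_point P = ?r1 s" "end_point P = ?r2 t"
        using gs X le_less_trans[OF st(3) M(1)] unfolding geodesic_space_def by fastforce
      have gi: "geodesic_image X d (?r1 s) (?r2 t) (dpath_image P)"
        unfolding geodesic_image_def using P by blast
      have "e \<notin> out_ball X d r x \<union> in_ball X d r x" if "e \<in> dpath_image P" for e
      proof -
        have eX: "e \<in> X" using geo_ends[OF gi] that by blast
        have sub: "d (?r1 s) e \<le> M" "d e (?r2 t) \<le> M"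
          using ennreal_le_add_cancel[OF geo_between[OF gi that]] st(3) by auto
        have "\<not> d x e \<le> ennreal r"
          using dist_trans[OF x eX X(2) _ sub(2)] n1[of t] st(2) by auto
        moreover have "\<not> d e x \<le> ennreal r"
          using dist_trans[OF X(1) eX x sub(1)] n2[of s] st(1) by auto
        ultimately show ?thesis by (simp add: out_ball_def in_ball_def)
      qed
      then show "\<exists>P l. directed_path X d P \<and> start_point P \<in> gen_ray_image R1 \<and>
          end_point P \<in> gen_ray_image R2 \<and> has_length d P l \<and> l \<le> ennreal (enn2real M) \<and>
          dpath_image P \<inter> (out_ball X d r x \<union> in_ball X d r x) = {}"
        using P st M(1) unfolding geodesic_def gen_ray_image_outward
        by (intro exI[of _ P] exI[of _ "d (?r1 s) (?r2 t)"]) auto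
    qed simp
  }
qed

theorem proposition4p3:
  fixes X :: "'a set" and d :: "'a \<Rightarrow> 'a \<Rightarrow> ennreal"
  assumes "semimetric_space X d"
    and "geodesic_space X d"
    and "hyperbolic X d"
    and "B1 X d" and "B2 X d"
  shows "reflp_on (geodesic_rays_antirays X d) (ray_le X d) \<and>
         transp_on (geodesic_rays_antirays X d) (ray_le X d)"
proof -
  obtain \<delta> where "delta_hyperbolic X d \<delta>" using assms(3) unfolding hyperbolic_def by auto
  note hyp = hyperbolic_imp_directed_hyperbolic[OF assms(1,2) this assms(4,5)]
  interpret directed_hyperbolic X d "geodesic_image X d" "ennreal \<delta>" by (rule hyp)
  note iff = ray_le_iff_asymp_le[OF assms(1,2) hyp] and el = outward_escaping_line[OF assms(1) hyp]
  show ?thesis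
  proof (intro conjI reflp_onI transp_onI)
    fix R assume R: "R \<in> geodesic_rays_antirays X d"
    show "ray_le X d R R"
      unfolding iff[OF R R] by (rule asymp_le_refl[OF escaping_line_imp_line[OF el[OF R]]])
  next
    fix R1 R2 R3
    assume R: "R1 \<in> geodesic_rays_antirays X d" "R2 \<in> geodesic_rays_antirays X d"
      "R3 \<in> geodesic_rays_antirays X d" and le: "ray_le X d R1 R2" "ray_le X d R2 R3"
    show "ray_le X d R1 R3"
      using le unfolding iff[OF R(1,2)] iff[OF R(2,3)] iff[OF R(1,3)]
      by (rule asymp_le_trans[OF el[OF R(1)] el[OF R(2)] el[OF R(3)]])
  qed
qed
end
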